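(* Let $Y$ be a real topological vector space and $F,D\subseteq Y$. Then $\operatorname{WEff}(F,D)\neq\emptyset$ if $F\cap\operatorname{bd}(F+D)\neq\emptyset$. This condition ($F\cap\operatorname{bd}(F+D)\neq\emptyset$) is fulfilled if $F+D$ is a nonempty proper closed subset of $Y$, $D=D+D$, and $0\in D$.
   Context: $\operatorname{Eff}(F,D):=\{y^0\in F\mid F\cap(y^0-D)\subseteq\{y^0\}\}$ and $\operatorname{WEff}(F,D):=\operatorname{Eff}(F,\operatorname{int}D)$. $\operatorname{bd}$ denotes the topological boundary. *)

theory Defs
  imports "HOL-Analysis.Analysis" "HOL-Library.Set_Algebras"
begin

(* The topology is not assumed to be Hausdorff. Continuity of negation, part of
   topological_ab_group_add, also follows from continuity of scaling. *)
class topological_real_vector = real_vector + topological_ab_group_add +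
  assumes tendsto_scaleR_Pair:
    "LIM p (nhds r \<times>\<^sub>F nhds x). fst p *\<^sub>R snd p :> nhds (r *\<^sub>R x)"

lemma continuous_on_scaleR_Pair:
  "continuous_on UNIV (\<lambda>p :: real \<times> 'a::topological_real_vector. fst p *\<^sub>R snd p)"
proof -
  have "((\<lambda>p. fst p *\<^sub>R snd p) \<longlongrightarrow> fst p *\<^sub>R snd p) (at p)" for p :: "real \<times> 'a"
    using tendsto_scaleR_Pair[of "fst p" "snd p"]
    by (intro tendsto_mono[OF at_within_le_nhds]) (simp add: nhds_prod[symmetric])
  then show ?thesis
    by (simp add: continuous_on_def)
qed

instance real_normed_vector \<subseteq> topological_real_vector
proof
  fix r :: real and x :: 'a
  show "LIM p (nhds r \<times>\<^sub>F nhds x). fst p *\<^sub>R snd p :> nhds (r *\<^sub>R x)"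
    by (intro tendsto_scaleR filterlim_fst filterlim_snd)
qed

definition Eff :: "'a::real_vector set \<Rightarrow> 'a set \<Rightarrow> 'a set" where
  "Eff F D = {y0 \<in> F. F \<inter> ((\<lambda>d. y0 - d) ` D) \<subseteq> {y0}}"

definition WEff :: "'a::topological_real_vector set \<Rightarrow> 'a set \<Rightarrow> 'a set" where
  "WEff F D = Eff F (interior D)"

end

theory Submission
  imports Defs
begin

text \<open>
  Both parts rest on one observation: a translate of an open set is open, so
  \<open>S + interior D\<close> and \<open>interior S + D\<close> are open and hence lie in \<open>interior (S + D)\<close>.

  For the first part, a point of \<open>F\<close> on the boundary of \<open>F + D\<close> is not in \<open>F + interior D\<close>. So no
  point of \<open>F\<close> dominates it with respect to \<open>interior D\<close>, and the point itself is weakly efficient.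

  For the second part, put \<open>A = F + D\<close>. Then \<open>A + D = A\<close>, and \<open>F \<subseteq> A\<close> because \<open>0 \<in> D\<close>. If \<open>F\<close> missed
  the boundary of \<open>A\<close>, it would lie in \<open>interior A\<close>, so that
  \<open>A = F + D \<subseteq> interior A + D \<subseteq> interior (A + D) = interior A\<close>. Thus \<open>A\<close> would be open as well as
  closed, which is impossible for a nonempty proper subset because a topological vector space is
  connected.
\<close>

lemma open_set_plus:
  fixes S U :: "'a::topological_ab_group_add set"
  assumes "open U"
  shows "open (S + U)"
proof -
  have "open ((\<lambda>z. z - s) -` U)" for s
    by (intro open_vimage assms continuous_intros)
  moreover have "S + U = (\<Union>s\<in>S. (\<lambda>z. z - s) -` U)"
  proof (intro subset_antisym subsetI)
    fix z assume "z \<in> S + U"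
    then show "z \<in> (\<Union>s\<in>S. (\<lambda>z. z - s) -` U)"
      by (elim set_plus_elim, intro UN_I) (auto simp: algebra_simps)
  next
    fix z assume "z \<in> (\<Union>s\<in>S. (\<lambda>z. z - s) -` U)"
    then obtain s where "s \<in> S" "z - s \<in> U"
      by auto
    then have "s + (z - s) \<in> S + U"
      by (rule set_plus_intro)
    then show "z \<in> S + U"
      by simp
  qed
  ultimately show ?thesis
    by auto
qed

lemma set_plus_interior_subset:
  fixes S U :: "'a::topological_ab_group_add set"
  shows "S + interior U \<subseteq> interior (S + U)"
  by (intro interior_maximal set_plus_mono2 order_refl interior_subset open_set_plus open_interior)

text \<open>
  The line through two given points is a continuous image of the real line, hence connected.
\<close>

lemma connected_UNIV_topological_real_vector:
  "connected (UNIV :: 'a::topological_real_vector set)"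
proof -
  have "\<exists>L. connected L \<and> a \<in> L \<and> b \<in> L" for a b :: 'a
  proof (intro exI conjI)
    let ?line = "\<lambda>t. a + t *\<^sub>R (b - a)"
    have "continuous_on UNIV (\<lambda>t::real. t *\<^sub>R (b - a))"
      using continuous_on_compose2[OF continuous_on_scaleR_Pair,
          of UNIV "\<lambda>t. (t, b - a)"]
      by (simp add: continuous_on_Pair)
    then show "connected (range ?line)"
      by (intro connected_continuous_image continuous_intros connected_UNIV)
    show "a \<in> range ?line"
      by (rule range_eqI[of _ _ 0]) simp
    show "b \<in> range ?line"
      by (rule range_eqI[of _ _ 1]) simp
  qed
  then show ?thesis
    by (subst connected_iff_connected_component)
       (auto simp: connected_component_def)
qed

text \<open>
  If \<open>y - d \<in> F\<close> with \<open>d \<in> interior D\<close>, then \<open>y \<in> F + interior D\<close>, and \<open>y\<close> is interior to \<open>F + D\<close>.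
\<close>

lemma frontier_subset_WEff:
  "F \<inter> frontier (F + D) \<subseteq> WEff F D"
proof
  fix y assume y: "y \<in> F \<inter> frontier (F + D)"
  have "y - d \<notin> F" if "d \<in> interior D" for d
  proof
    assume "y - d \<in> F"
    then have "(y - d) + d \<in> F + interior D"
      using that by (rule set_plus_intro)
    then have "y \<in> interior (F + D)"
      using set_plus_interior_subset[of F D] by auto
    with y show False
      by (simp add: frontier_def)
  qed
  with y show "y \<in> WEff F D"
    by (auto simp: WEff_def Eff_def)
qed

text \<open>
  The inclusion of \<open>F\<close> in the interior spreads to all of \<open>F + D\<close>: adding \<open>D\<close> maps the interior of
  \<open>F + D\<close> into the interior of \<open>F + D + D\<close>, and \<open>F + D + D = F + D\<close>.
\<close>

lemma subset_interior_imp_open_set_plus: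
  fixes F D :: "'a::topological_ab_group_add set"
  assumes "F \<subseteq> interior (F + D)" "D + D = D"
  shows "open (F + D)"
proof -
  have "F + D \<subseteq> interior (F + D) + D"
    using assms(1) by (intro set_plus_mono2 order_refl)
  also have "\<dots> \<subseteq> interior ((F + D) + D)"
    using set_plus_interior_subset[of D "F + D"] by (simp add: add.commute)
  also have "(F + D) + D = F + D"
    by (simp add: add.assoc assms(2))
  finally have "interior (F + D) = F + D"
    by (intro subset_antisym interior_subset)
  then show ?thesis
    by (simp only: interior_eq)
qed

theorem corollary3:
  fixes F D :: "'a::topological_real_vector set"
  shows "(F \<inter> frontier (F + D) \<noteq> {} \<longrightarrow> WEff F D \<noteq> {}) \<and>
    (F + D \<noteq> {} \<and> F + D \<noteq> UNIV \<and> closed (F + D) \<and> D = D + D \<and> 0 \<in> D \<longrightarrow>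
      F \<inter> frontier (F + D) \<noteq> {})"
proof (intro conjI impI)
  assume "F \<inter> frontier (F + D) \<noteq> {}"
  then show "WEff F D \<noteq> {}"
    using frontier_subset_WEff[of F D] by blast
next
  assume A: "F + D \<noteq> {} \<and> F + D \<noteq> UNIV \<and> closed (F + D) \<and> D = D + D \<and> 0 \<in> D"
  show "F \<inter> frontier (F + D) \<noteq> {}"
  proof
    assume "F \<inter> frontier (F + D) = {}"
    moreover have "F \<subseteq> F + D"
      using A set_plus_intro[of _ F 0 D] by auto
    ultimately have "F \<subseteq> interior (F + D)"
      using A by (auto simp: frontier_def)
    then have "open (F + D)"
      using A by (intro subset_interior_imp_open_set_plus) auto
    moreover have "open (- (F + D))"
      using A by (simp only: open_Compl)
    ultimately show False
      using A connectedD[OF connected_UNIV_topological_real_vector, of "F + D" "- (F + D)"] by auto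
  qed
qed

end
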